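(* For any distinct prime numbers $p,q$ and natural numbers $n,m\ge 1$, $$Cl_2(\mathbb{Z}_{p^nq^m})\cong\begin{cases}Sh^2_{q^m-q^{m-1}}, & \text{if } p^n=2,\\ Sh^4_{2(q^m-q^{m-1})}, & \text{if } p^n=4,\\ Sh^8_{(p^n-p^{n-1})(q^m-q^{m-1})}, & \text{if } p=2,\ n\geq 3,\\ Sh^4_{(p^n-p^{n-1})(q^m-q^{m-1})}, & \text{if } p\neq 2 \text{ and } q\neq 2.\end{cases}$$
   Context: $\mathbb{Z}_N$ is the ring of integers modulo $N$. For a ring $R$ with identity, $Id(R)$ is the set of idempotents and $U(R)$ the set of units. $Cl_2(R)$ is the simple undirected graph with vertex set $\{(e,u): e\in Id(R)\setminus\{0\},\ u\in U(R)\}$, in which two distinct vertices $(e,u)$ and $(f,v)$ are adjacent if and only if $ef=fe=0$ or $uv=vu=1$. Shuriken graph: for $t=2^k$ with $k\in\mathbb{Z}^+\cup\{0\}$ and $n$ a multiple of $t$, $Sh^t_n$ is (up to isomorphism) the simple graph with vertex set $\{a_i,b_i,c_i: i=1,\dots,n\}$ and edge set $$\{a_ib_j: i,j\in\{1,\dots,n\}\}\cup\{a_ic_i,\ b_ic_i: i=1,\dots,t\}\cup\{a_ic_{n+t+1-i},\ b_ic_{n+t+1-i}: t+1\le i\le n\}\cup\left\{a_ia_{n+t+1-i},\ b_ib_{n+t+1-i},\ c_ic_{n+t+1-i}: t+1\le i\le \tfrac{n+t}{2}\right\}.$$ *)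

theory Defs
  imports
    "HOL-Number_Theory.Residues"
    "Graph_Theory.Pair_Digraph"
    "Graph_Theory.Digraph_Isomorphism"
begin

text \<open>
  As usual in the \<open>Graph_Theory\<close> library, a simple undirected graph is a
  \<^locale>\<open>pair_graph\<close>: every edge is represented by both of its orientations.
  On such graphs \<^const>\<open>digraph_iso\<close> is isomorphism of simple graphs, since an arc
  is determined by its end points.
\<close>

definition idempotents :: "('a, 'r) ring_scheme \<Rightarrow> 'a set" where
  "idempotents R = {e \<in> carrier R. e \<otimes>\<^bsub>R\<^esub> e = e}"

definition Cl2 :: "('a, 'r) ring_scheme \<Rightarrow> ('a \<times> 'a) pair_pre_digraph" where
  "Cl2 R =
    (let V = (idempotents R - {\<zero>\<^bsub>R\<^esub>}) \<times> Units R
     in \<lparr> pverts = V,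
          parcs = {((e, u), (f, v)) | e u f v.
            (e, u) \<in> V \<and> (f, v) \<in> V \<and> (e, u) \<noteq> (f, v) \<and>
            (e \<otimes>\<^bsub>R\<^esub> f = \<zero>\<^bsub>R\<^esub> \<and> f \<otimes>\<^bsub>R\<^esub> e = \<zero>\<^bsub>R\<^esub> \<or>
             u \<otimes>\<^bsub>R\<^esub> v = \<one>\<^bsub>R\<^esub> \<and> v \<otimes>\<^bsub>R\<^esub> u = \<one>\<^bsub>R\<^esub>)} \<rparr>)"

datatype shuriken_vertex = A nat | B nat | C nat

text \<open>
  \<open>shuriken t n\<close> is the graph $Sh^t_n$. It is meant for \<open>t\<close> a power of two and
  \<open>n\<close> a multiple of \<open>t\<close>, although the definition makes sense for all \<open>t\<close> and \<open>n\<close>.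
  The bound $i \le (n+t)/2$ is written without division; the differences
  \<open>n + t + 1 - i\<close> are not truncated, because \<open>i \<le> n\<close> or \<open>2 * i \<le> n + t\<close>.
\<close>

definition shuriken :: "nat \<Rightarrow> nat \<Rightarrow> shuriken_vertex pair_pre_digraph" where
  "shuriken t n = mk_symmetric
    \<lparr> pverts = A ` {1..n} \<union> B ` {1..n} \<union> C ` {1..n},
      parcs =
        {(A i, B j) | i j. i \<in> {1..n} \<and> j \<in> {1..n}} \<union>
        {(A i, C i) | i. i \<in> {1..t}} \<union>
        {(B i, C i) | i. i \<in> {1..t}} \<union>
        {(A i, C (n + t + 1 - i)) | i. t + 1 \<le> i \<and> i \<le> n} \<union>
        {(B i, C (n + t + 1 - i)) | i. t + 1 \<le> i \<and> i \<le> n} \<union>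
        {(A i, A (n + t + 1 - i)) | i. t + 1 \<le> i \<and> 2 * i \<le> n + t} \<union>
        {(B i, B (n + t + 1 - i)) | i. t + 1 \<le> i \<and> 2 * i \<le> n + t} \<union>
        {(C i, C (n + t + 1 - i)) | i. t + 1 \<le> i \<and> 2 * i \<le> n + t} \<rparr>"

lemma pair_graphI:
  assumes "finite (pverts G)"
    and "\<And>x y. (x, y) \<in> parcs G \<Longrightarrow> x \<in> pverts G"
    and "\<And>x y. (x, y) \<in> parcs G \<Longrightarrow> x \<noteq> y"
    and "\<And>x y. (x, y) \<in> parcs G \<Longrightarrow> (y, x) \<in> parcs G"
  shows "pair_graph G"
proof unfold_locales
  have "parcs G \<subseteq> pverts G \<times> pverts G"
    using assms(2,4) by auto
  then show "finite (parcs G)"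
    using assms(1) by (meson finite_SigmaI finite_subset)
qed (use assms in \<open>force simp: symmetric_def intro: symI\<close>)+

lemma pair_graph_Cl2:
  assumes "finite (carrier R)"
  shows "pair_graph (Cl2 R)"
proof (rule pair_graphI)
  have "pverts (Cl2 R) \<subseteq> carrier R \<times> carrier R"
    by (auto simp: Cl2_def idempotents_def Units_def)
  then show "finite (pverts (Cl2 R))"
    using assms by (meson finite_SigmaI finite_subset)
qed (auto simp: Cl2_def Let_def)

lemma pair_graph_mk_symmetric:
  fixes G :: "'a pair_pre_digraph"
  assumes "finite (pverts G)"
    and "\<And>x y. (x, y) \<in> parcs G \<Longrightarrow> x \<in> pverts G \<and> y \<in> pverts G \<and> x \<noteq> y"
  shows "pair_graph (mk_symmetric G)"
proof -
  have arcs: "(x, y) \<in> parcs (mk_symmetric G) \<longleftrightarrow> (x, y) \<in> parcs G \<or> (y, x) \<in> parcs G" for x y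
    by (simp add: parcs_mk_symmetric) (metis fst_conv prod.collapse snd_conv)
  show ?thesis
    using assms(1) by (intro pair_graphI) (auto simp: arcs dest: assms(2))
qed

lemma pair_graph_shuriken:
  assumes "t \<le> n"
  shows "pair_graph (shuriken t n)"
  unfolding shuriken_def
proof (rule pair_graph_mk_symmetric, goal_cases)
  case (2 x y)
  then show ?case
    using assms unfolding pair_pre_digraph.simps Un_iff mem_Collect_eq
    by (elim disjE exE conjE) (simp_all add: image_iff, arith+)
qed simp

end

theory Submission
  imports Defs
begin

text \<open>
  Let $N = p^n q^m$. Whether \<open>(e, u)\<close> and \<open>(f, v)\<close> are adjacent depends only on the products
  \<open>e f\<close> and on the involution \<open>u \<mapsto> u\<inverse>\<close> of the unit group. Both are explicit for $\mathbb{Z}_N$.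

  By the Chinese remainder theorem an idempotent modulo \<open>N\<close> is a choice of 0 or 1 modulo each of
  the two prime powers, so the nonzero ones are \<open>1\<close> and two idempotents \<open>e\<close>, \<open>f\<close> with \<open>e f = 0\<close>
  (\<open>idempotents_residue_ring\<close>). The only product among them that vanishes is \<open>e f\<close>. Hence the
  layers \<open>{e} \<times> U\<close> and \<open>{f} \<times> U\<close> are completely joined, and every other edge is of the form
  \<open>(x, u) (y, u\<inverse>)\<close>.

  In the shuriken graph the layers \<open>A\<close> and \<open>B\<close> are completely joined, and every other edge joins a
  vertex of index \<open>i\<close> to one of index \<open>\<mu> i\<close>, where the involution \<open>\<mu>\<close> of \<open>{1..n}\<close> fixes
  \<open>1, \<dots>, t\<close> and reverses the order of the other indices (\<open>shuriken_arc_iff\<close>). So it suffices to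
  enumerate the units in such a way that inversion becomes \<open>\<mu>\<close>. An involution is determined up to
  relabelling by its number of fixed points (\<open>involution_enumeration\<close>), and the result for an
  arbitrary commutative ring with these idempotents is \<open>Cl2_iso_shuriken\<close>, where \<open>t\<close> counts the
  units that are their own inverses.

  It remains to count. The number of units is Euler's totient, and the solutions of $x^2 = 1$
  modulo \<open>N\<close> are counted by the product of the numbers for the two prime powers
  (\<open>card_square_roots_of_one_mult\<close>). An odd prime power has the two solutions \<open>\<plusminus>1\<close>. The powers
  of two have 1 solution modulo 2, 2 modulo 4 and 4 modulo each higher power. This gives
  \<open>t = 2, 4, 8, 4\<close> in the four cases.
\<close>

section \<open>Isomorphisms of simple graphs\<close>

text \<open>
  An arc of a graph without parallel arcs is a pair of vertices, so the arc map of an isomorphism is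
  forced by the vertex map.
\<close>

lemma digraph_iso_with_projI:
  assumes bij: "bij_betw f (pverts G) (pverts H)"
    and G: "parcs G \<subseteq> pverts G \<times> pverts G" and H: "parcs H \<subseteq> pverts H \<times> pverts H"
    and arcs: "\<And>x y. x \<in> pverts G \<Longrightarrow> y \<in> pverts G \<Longrightarrow>
      (f x, f y) \<in> parcs H \<longleftrightarrow> (x, y) \<in> parcs G"
  shows "digraph_iso (with_proj G) (with_proj H)"
proof -
  define \<phi> where "\<phi> = \<lparr>iso_verts = f, iso_arcs = map_prod f f, iso_head = snd, iso_tail = fst\<rparr>"
  have inj: "inj_on f (pverts G)" and im: "f ` pverts G = pverts H"
    using bij by (auto simp: bij_betw_def)
  have "inj_on (map_prod f f) (parcs G)"
    using G inj map_prod_inj_on inj_on_subset by metis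
  moreover have "wf_digraph (with_proj G)"
    using G by unfold_locales auto
  ultimately have "pre_digraph.digraph_isomorphism (with_proj G) \<phi>"
    using inj by (auto simp: pre_digraph.digraph_isomorphism_def \<phi>_def)
  moreover have "map_prod f f ` parcs G = parcs H"
  proof
    show "map_prod f f ` parcs G \<subseteq> parcs H"
      using G arcs by auto
    show "parcs H \<subseteq> map_prod f f ` parcs G"
    proof clarify
      fix x y assume xy: "(x, y) \<in> parcs H"
      then obtain x' y' where "x' \<in> pverts G" "y' \<in> pverts G" "x = f x'" "y = f y'"
        using H im by blast
      with xy show "(x, y) \<in> map_prod f f ` parcs G"
        using arcs by (force simp: image_iff)
    qed
  qed
  then have "with_proj H = app_iso \<phi> (with_proj G)"
    by (simp add: app_iso_def \<phi>_def with_proj_def im)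
  ultimately show ?thesis
    unfolding digraph_iso_def by blast
qed

section \<open>Adjacency in the shuriken graph\<close>

text \<open>
  For \<open>t \<le> n\<close>, an involution of \<open>{1..n}\<close>: on \<open>{t+1..n}\<close> it is the order reversal.
\<close>

definition mirror :: "nat \<Rightarrow> nat \<Rightarrow> nat \<Rightarrow> nat" where
  "mirror t n i = (if i \<le> t then i else n + t + 1 - i)"

text \<open>
  All the edge families of the shuriken graph other than the complete join of \<open>A\<close> and \<open>B\<close> are
  instances of the single condition \<open>j = mirror t n i\<close>. The bound \<open>2 * i \<le> n + t\<close> in the definition
  selects one orientation of each edge within a layer, and it leaves out an index that is its own
  mirror image, which would give a loop.
\<close>

lemma shuriken_arc_iff:
  assumes "t \<le> n" "i \<in> {1..n}" "j \<in> {1..n}"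
  shows "(A i, A j) \<in> parcs (shuriken t n) \<longleftrightarrow> i \<noteq> j \<and> j = mirror t n i"
    and "(B i, B j) \<in> parcs (shuriken t n) \<longleftrightarrow> i \<noteq> j \<and> j = mirror t n i"
    and "(C i, C j) \<in> parcs (shuriken t n) \<longleftrightarrow> i \<noteq> j \<and> j = mirror t n i"
    and "(A i, B j) \<in> parcs (shuriken t n)" and "(B i, A j) \<in> parcs (shuriken t n)"
    and "(A i, C j) \<in> parcs (shuriken t n) \<longleftrightarrow> j = mirror t n i"
    and "(B i, C j) \<in> parcs (shuriken t n) \<longleftrightarrow> j = mirror t n i"
    and "(C i, A j) \<in> parcs (shuriken t n) \<longleftrightarrow> j = mirror t n i"
    and "(C i, B j) \<in> parcs (shuriken t n) \<longleftrightarrow> j = mirror t n i"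
proof -
  have sym: "(x, y) \<in> parcs (mk_symmetric (with_proj G)) \<longleftrightarrow> (x, y) \<in> parcs G \<or> (y, x) \<in> parcs G"
    for x y and G :: "shuriken_vertex pair_pre_digraph"
    by (simp add: parcs_mk_symmetric) (metis fst_conv prod.collapse snd_conv)
  have le: "i \<le> n" "j \<le> n"
    using assms by auto
  \<comment> \<open>Linear arithmetic decides the nine equivalences at once when no truncated difference is left.\<close>
  have pair: "k = n + t + 1 - l \<longleftrightarrow> k + l = n + t + 1" if "l \<le> n" for k l
    using that assms(1) by auto
  note arcs = shuriken_def sym mirror_def pair_pre_digraph.simps Un_iff mem_Collect_eq prod.inject
  show "(A i, A j) \<in> parcs (shuriken t n) \<longleftrightarrow> i \<noteq> j \<and> j = mirror t n i"
    and "(B i, B j) \<in> parcs (shuriken t n) \<longleftrightarrow> i \<noteq> j \<and> j = mirror t n i"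
    and "(C i, C j) \<in> parcs (shuriken t n) \<longleftrightarrow> i \<noteq> j \<and> j = mirror t n i"
    and "(A i, B j) \<in> parcs (shuriken t n)" and "(B i, A j) \<in> parcs (shuriken t n)"
    and "(A i, C j) \<in> parcs (shuriken t n) \<longleftrightarrow> j = mirror t n i"
    and "(B i, C j) \<in> parcs (shuriken t n) \<longleftrightarrow> j = mirror t n i"
    and "(C i, A j) \<in> parcs (shuriken t n) \<longleftrightarrow> j = mirror t n i"
    and "(C i, B j) \<in> parcs (shuriken t n) \<longleftrightarrow> j = mirror t n i"
    using assms
    by (simp_all add: arcs pair[OF le(1)] pair[OF le(2)]
        del: One_nat_def add_Suc_right Suc_eq_plus1) arith+
qed

lemma pverts_shuriken: "pverts (shuriken t n) = A ` {1..n} \<union> B ` {1..n} \<union> C ` {1..n}"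
  by (simp add: shuriken_def)

lemma parcs_shuriken_subset:
  assumes "t \<le> n"
  shows "parcs (shuriken t n) \<subseteq> pverts (shuriken t n) \<times> pverts (shuriken t n)"
proof -
  interpret pair_graph "shuriken t n"
    using assms by (rule pair_graph_shuriken)
  show ?thesis
    by (auto dest: in_arcsD1 in_arcsD2)
qed

section \<open>Normal form of an involution\<close>

lemma fixpoint_free_involution_transversal:
  assumes "finite U" and "\<And>x. x \<in> U \<Longrightarrow> \<sigma> x \<in> U" and "\<And>x. x \<in> U \<Longrightarrow> \<sigma> (\<sigma> x) = x"
    and "\<And>x. x \<in> U \<Longrightarrow> \<sigma> x \<noteq> x"
  obtains xs where "distinct (xs @ map \<sigma> xs)" and "set (xs @ map \<sigma> xs) = U"
  using assms
proof (induction U arbitrary: thesis rule: finite_psubset_induct)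
  case (psubset U)
  show ?case
  proof (cases "U = {}")
    case True
    then show ?thesis using psubset.prems(1)[of "[]"] by simp
  next
    case False
    then obtain x where x: "x \<in> U" by auto
    let ?V = "U - {x, \<sigma> x}"
    have "?V \<subset> U" using x by auto
    moreover have "\<sigma> y \<in> ?V" if "y \<in> ?V" for y
      using that psubset.prems x by (metis DiffE DiffI insert_iff empty_iff)
    ultimately obtain xs where xs: "distinct (xs @ map \<sigma> xs)" "set (xs @ map \<sigma> xs) = ?V"
      using psubset.IH[of ?V] psubset.prems by (metis DiffD1)
    show ?thesis
    proof (rule psubset.prems(1)[of "x # xs"])
      have "x \<notin> set (xs @ map \<sigma> xs)" "\<sigma> x \<notin> set (xs @ map \<sigma> xs)" "\<sigma> x \<noteq> x"
        using xs(2) psubset.prems(4) x by auto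
      then show "distinct ((x # xs) @ map \<sigma> (x # xs))"
        using xs(1) by auto
      show "set ((x # xs) @ map \<sigma> (x # xs)) = U"
        using xs(2) x psubset.prems(2)[OF x] by auto
    qed
  qed
qed

text \<open>
  The enumeration lists the fixed points, then one point \<open>x\<close> of each orbit of size two, and then the
  partners \<open>\<sigma> x\<close> in reverse order. The reversal makes partners sit at indices whose sum is the
  constant \<open>n + t + 1\<close>.
\<close>

lemma involution_enumeration:
  assumes fin: "finite U" and clos: "\<And>x. x \<in> U \<Longrightarrow> \<sigma> x \<in> U"
    and invol: "\<And>x. x \<in> U \<Longrightarrow> \<sigma> (\<sigma> x) = x"
  defines "n \<equiv> card U" and "t \<equiv> card {x \<in> U. \<sigma> x = x}"
  obtains u where "bij_betw u {1..n} U" and "\<And>i. i \<in> {1..n} \<Longrightarrow> \<sigma> (u i) = u (mirror t n i)"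
proof -
  let ?F = "{x \<in> U. \<sigma> x = x}"
  obtain fs where fs: "distinct fs" "set fs = ?F"
    using finite_distinct_list[of ?F] fin by auto
  have lt: "length fs = t"
    using fs distinct_card t_def by metis
  obtain xs where xs: "distinct (xs @ map \<sigma> xs)" "set (xs @ map \<sigma> xs) = U - ?F"
  proof (rule fixpoint_free_involution_transversal[of "U - ?F" \<sigma>])
    show "\<sigma> x \<in> U - ?F" if "x \<in> U - ?F" for x
      using that clos invol by (metis (mono_tags, lifting) DiffE DiffI mem_Collect_eq)
  qed (use fin invol in auto)
  define k where "k = length xs"
  define zs where "zs = fs @ xs @ rev (map \<sigma> xs)"
  have "distinct zs" and "set zs = U"
    using fs xs by (auto simp: zs_def)
  then have n: "n = t + 2 * k" and lz: "length zs = n"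
    using distinct_card[of zs] by (auto simp: n_def zs_def lt k_def)
  define u where "u i = zs ! (i - 1)" for i
  have "bij_betw ((!) zs) {..<n} U"
    using \<open>distinct zs\<close> \<open>set zs = U\<close> lz by (metis bij_betw_nth lessThan_atLeast0)
  moreover have "bij_betw (\<lambda>i. i - 1) {1..n} {..<n}"
    by (rule bij_betw_byWitness[where f' = Suc]) auto
  ultimately have bij: "bij_betw u {1..n} U"
    unfolding u_def using bij_betw_trans[of "\<lambda>i. i - 1" "{1..n}" "{..<n}" "(!) zs" U]
    by (simp add: comp_def)
  have first: "u i = fs ! (i - 1)" "u i \<in> ?F" if "i \<in> {1..t}" for i
  proof -
    show "u i = fs ! (i - 1)"
      using that lt by (auto simp: u_def zs_def nth_append)
    moreover have "i - 1 < length fs"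
      using that lt by auto
    ultimately show "u i \<in> ?F"
      using fs(2) nth_mem by metis
  qed
  have mid: "u i = xs ! (i - t - 1)" if "i \<in> {t+1..t+k}" for i
  proof -
    have "i - 1 - t = i - t - 1" "i - t - 1 < k" "\<not> i - 1 < t" using that by auto
    then show ?thesis by (simp add: u_def zs_def nth_append lt k_def)
  qed
  have last: "u (n + t + 1 - i) = \<sigma> (xs ! (i - t - 1))" if "i \<in> {t+1..t+k}" for i
  proof -
    let ?j = "n + t + 1 - i"
    have "\<not> ?j - 1 < t" "\<not> ?j - 1 - t < k" "?j - 1 - t - k < k" 
      "k - Suc (?j - 1 - t - k) = i - t - 1" "i - t - 1 < k"
      using that n by auto
    then show ?thesis
      by (simp add: u_def zs_def nth_append lt k_def[symmetric] rev_nth)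
  qed
  have "\<sigma> (u i) = u (mirror t n i)" if "i \<in> {1..n}" for i
  proof -
    have "i \<in> {1..t} \<or> i \<in> {t+1..t+k} \<or> i \<in> {t+k+1..n}"
      using that by auto
    then consider "i \<in> {1..t}" | "i \<in> {t+1..t+k}" | "i \<in> {t+k+1..n}"
      by blast
    then show ?thesis
    proof cases
      case 1
      then show ?thesis using first(2) by (simp add: mirror_def)
    next
      case 2
      then show ?thesis using mid last by (simp add: mirror_def)
    next
      case 3
      let ?j = "n + t + 1 - i"
      have j: "?j \<in> {t+1..t+k}" "?j \<in> {1..n}" "n + t + 1 - ?j = i"
        using 3 n by auto
      then have "u i = \<sigma> (u ?j)"
        using last[of ?j] mid[of ?j] by simp
      moreover have "u ?j \<in> U"
        using j(2) bij_betwE[OF bij] by blast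
      ultimately show ?thesis
        using 3 invol by (simp add: mirror_def)
    qed
  qed
  with bij show thesis by (rule that)
qed

section \<open>Clean graphs of rings with four idempotents\<close>

lemma (in cring) Cl2_arc_iff:
  assumes "(a, v) \<in> pverts (Cl2 R)" "(b, w) \<in> pverts (Cl2 R)"
  shows "((a, v), (b, w)) \<in> parcs (Cl2 R) \<longleftrightarrow> (a, v) \<noteq> (b, w) \<and> (a \<otimes> b = \<zero> \<or> w = inv v)"
proof -
  have ab: "a \<in> carrier R" "b \<in> carrier R" and vw: "v \<in> Units R" "w \<in> Units R"
    using assms by (auto simp: Cl2_def idempotents_def Let_def)
  have "v \<otimes> w = \<one> \<longleftrightarrow> w = inv v"
    using vw by (metis Units_closed Units_r_inv comm_inv_char)
  moreover have "a \<otimes> b = b \<otimes> a" "v \<otimes> w = w \<otimes> v"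
    using ab vw by (auto intro: m_comm Units_closed)
  ultimately show ?thesis
    using assms by (auto simp: Cl2_def Let_def)
qed

lemma (in cring) pverts_Cl2: "pverts (Cl2 R) = (idempotents R - {\<zero>}) \<times> Units R"
  by (simp add: Cl2_def Let_def)

text \<open>
  Among the products of two nonzero idempotents only \<open>e f\<close> and \<open>f e\<close> vanish: squares and products
  with \<open>1\<close> are nonzero idempotents again. Therefore \<open>e\<close>, \<open>f\<close>, \<open>1\<close> take the places of \<open>A\<close>, \<open>B\<close>, \<open>C\<close>,
  and an enumeration of the units that turns inversion into the mirror map does the rest.
\<close>

theorem (in cring) Cl2_iso_shuriken:
  assumes fin: "finite (Units R)"
    and idem: "idempotents R = {\<zero>, \<one>, e, f}" and dist: "distinct [\<zero>, \<one>, e, f]"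
    and ef: "e \<otimes> f = \<zero>"
  shows "digraph_iso (with_proj (Cl2 R))
    (with_proj (shuriken (card {u \<in> Units R. u \<otimes> u = \<one>}) (card (Units R))))"
proof -
  define n where "n = card (Units R)"
  define t where "t = card {u \<in> Units R. inv u = u}"
  have inv_fix: "inv u = u \<longleftrightarrow> u \<otimes> u = \<one>" if "u \<in> Units R" for u
    using that by (metis Units_closed Units_r_inv comm_inv_char)
  have tn: "t \<le> n"
    unfolding t_def n_def using fin by (intro card_mono) auto
  obtain u where bij: "bij_betw u {1..n} (Units R)"
    and inv_u: "\<And>i. i \<in> {1..n} \<Longrightarrow> inv (u i) = u (mirror t n i)"
    using involution_enumeration[of "Units R" "\<lambda>x. inv x", folded n_def t_def] fin by auto
  have u_inj: "u i = u j \<longleftrightarrow> i = j" if "i \<in> {1..n}" "j \<in> {1..n}" for i j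
    using bij that by (auto simp: bij_betw_def inj_on_eq_iff)
  have u_Units: "u i \<in> Units R" if "i \<in> {1..n}" for i
    using bij that by (auto dest: bij_betwE)
  have mirror: "mirror t n i \<in> {1..n}" if "i \<in> {1..n}" for i
    using that tn by (auto simp: mirror_def)
  define h where "h x = (case x of A i \<Rightarrow> (e, u i) | B i \<Rightarrow> (f, u i) | C i \<Rightarrow> (\<one>, u i))" for x
  have nz: "idempotents R - {\<zero>} = {e, f, \<one>}"
    using idem dist by auto
  have carr: "e \<in> carrier R" "f \<in> carrier R" and sq: "e \<otimes> e = e" "f \<otimes> f = f"
    using idem by (auto simp: idempotents_def)
  have fe: "f \<otimes> e = \<zero>"
    using ef carr by (simp add: m_comm)
  have "digraph_iso (with_proj (shuriken t n)) (with_proj (Cl2 R))"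
  proof (rule digraph_iso_with_projI)
    have "inj_on h (pverts (shuriken t n))"
      using dist by (auto simp: inj_on_def pverts_shuriken h_def u_inj)
    moreover have "h ` pverts (shuriken t n) = pverts (Cl2 R)"
    proof -
      have "h ` pverts (shuriken t n) = {e, f, \<one>} \<times> u ` {1..n}"
        by (auto simp: pverts_shuriken h_def image_Un image_image)
      then show ?thesis
        using bij nz by (simp add: pverts_Cl2 bij_betw_def)
    qed
    ultimately show "bij_betw h (pverts (shuriken t n)) (pverts (Cl2 R))"
      by (simp add: bij_betw_def)
    show "parcs (shuriken t n) \<subseteq> pverts (shuriken t n) \<times> pverts (shuriken t n)"
      using tn by (rule parcs_shuriken_subset)
    show "parcs (Cl2 R) \<subseteq> pverts (Cl2 R) \<times> pverts (Cl2 R)"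
      by (auto simp: Cl2_def Let_def)
    fix x y assume xy: "x \<in> pverts (shuriken t n)" "y \<in> pverts (shuriken t n)"
    have V: "(a, u i) \<in> pverts (Cl2 R)" if "a \<in> {e, f, \<one>}" "i \<in> {1..n}" for a i
      using that nz u_Units by (auto simp: pverts_Cl2)
    have arc: "((a, u i), (b, u j)) \<in> parcs (Cl2 R) \<longleftrightarrow>
        (a, i) \<noteq> (b, j) \<and> (a \<otimes> b = \<zero> \<or> j = mirror t n i)"
      if "a \<in> {e, f, \<one>}" "b \<in> {e, f, \<one>}" "i \<in> {1..n}" "j \<in> {1..n}" for a b i j
      using Cl2_arc_iff[OF V V, of a i b j] that u_inj mirror inv_u by simp
    show "(h x, h y) \<in> parcs (Cl2 R) \<longleftrightarrow> (x, y) \<in> parcs (shuriken t n)"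
      using xy carr dist ef fe sq tn
      by (auto simp: pverts_shuriken h_def arc shuriken_arc_iff)
  qed
  moreover have "wf_digraph (with_proj (shuriken t n))"
    using parcs_shuriken_subset[OF tn] by unfold_locales auto
  ultimately have "digraph_iso (with_proj (Cl2 R)) (with_proj (shuriken t n))"
    by (rule digraph_iso_swap[rotated])
  moreover have "t = card {u \<in> Units R. u \<otimes> u = \<one>}"
    unfolding t_def using inv_fix by (metis (no_types, lifting))
  ultimately show ?thesis
    by (simp add: n_def)
qed

section \<open>Idempotents and square roots of one modulo an integer\<close>

definition square_roots_of_one :: "int \<Rightarrow> int set" where
  "square_roots_of_one N = {x \<in> {0..<N}. [x * x = 1] (mod N)}"

lemma chinese_remainder_bij_betw:
  fixes a b :: int
  assumes "coprime a b" "a > 0" "b > 0"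
  shows "bij_betw (\<lambda>x. (x mod a, x mod b)) {0..<a * b} ({0..<a} \<times> {0..<b})"
proof (rule bij_betw_imageI)
  show "inj_on (\<lambda>x. (x mod a, x mod b)) {0..<a * b}"
  proof (rule inj_onI)
    fix x y assume xy: "x \<in> {0..<a * b}" "y \<in> {0..<a * b}" "(x mod a, x mod b) = (y mod a, y mod b)"
    then have "[x = y] (mod a * b)"
      using assms(1) by (intro coprime_cong_mult) (auto simp: cong_def)
    then show "x = y"
      using xy by (simp add: cong_def)
  qed
  show "(\<lambda>x. (x mod a, x mod b)) ` {0..<a * b} = {0..<a} \<times> {0..<b}"
  proof
    show "{0..<a} \<times> {0..<b} \<subseteq> (\<lambda>x. (x mod a, x mod b)) ` {0..<a * b}"
    proof clarify
      fix r s assume rs: "r \<in> {0..<a}" "s \<in> {0..<b}"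
      obtain x where "[x = r] (mod a)" "[x = s] (mod b)"
        using binary_chinese_remainder_int[OF assms(1)] by blast
      then have "x mod (a * b) mod a = r" "x mod (a * b) mod b = s"
        using rs by (simp_all add: cong_def mod_mod_cancel)
      moreover have "x mod (a * b) \<in> {0..<a * b}"
        using assms by simp
      ultimately show "(r, s) \<in> (\<lambda>x. (x mod a, x mod b)) ` {0..<a * b}"
        by (metis (mono_tags, lifting) image_iff)
    qed
  qed (use assms in auto)
qed

lemma card_square_roots_of_one_mult:
  assumes "coprime a b" "a > 0" "b > 0"
  shows "card (square_roots_of_one (a * b)) = card (square_roots_of_one a) * card (square_roots_of_one b)"
proof -
  let ?h = "\<lambda>x. (x mod a, x mod b)"
  have *: "[x * x = 1] (mod a * b) \<longleftrightarrow>
      [(x mod a) * (x mod a) = 1] (mod a) \<and> [(x mod b) * (x mod b) = 1] (mod b)" for x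
    using assms(1) 
    by (metis cong_def cong_modulus_mult coprime_cong_mult mod_mult_eq mult.commute)
  have bij: "bij_betw ?h {0..<a * b} ({0..<a} \<times> {0..<b})"
    using assms by (rule chinese_remainder_bij_betw)
  have "bij_betw ?h (square_roots_of_one (a * b)) (square_roots_of_one a \<times> square_roots_of_one b)"
  proof (rule bij_betw_imageI)
    show "inj_on ?h (square_roots_of_one (a * b))"
      using bij by (auto simp: bij_betw_def square_roots_of_one_def intro: inj_on_subset)
    show "?h ` square_roots_of_one (a * b) = square_roots_of_one a \<times> square_roots_of_one b"
    proof
      show "?h ` square_roots_of_one (a * b) \<subseteq> square_roots_of_one a \<times> square_roots_of_one b"
        using * assms by (auto simp: square_roots_of_one_def)
      show "square_roots_of_one a \<times> square_roots_of_one b \<subseteq> ?h ` square_roots_of_one (a * b)"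
      proof clarify
        fix r s assume rs: "r \<in> square_roots_of_one a" "s \<in> square_roots_of_one b"
        then have "(r, s) \<in> ?h ` {0..<a * b}"
          using bij by (auto simp: bij_betw_def square_roots_of_one_def)
        then obtain x where "x \<in> {0..<a * b}" "r = x mod a" "s = x mod b"
          by auto
        then show "(r, s) \<in> ?h ` square_roots_of_one (a * b)"
          using rs * by (auto simp: square_roots_of_one_def)
      qed
    qed
  qed
  then show ?thesis
    by (simp add: bij_betw_same_card card_cartesian_product)
qed

text \<open>
  The prime divides at most one factor, and the other factor is then coprime to its powers.
  This applies to \<open>x (x - 1)\<close>, where the factors are coprime, and for odd \<open>p\<close> to
  \<open>(x - 1) (x + 1)\<close>, where a common divisor divides 2.
\<close>

lemma prime_power_dvd_mult_cancel:
  fixes p :: nat and a b :: int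
  assumes "prime p" and "int p ^ k dvd a * b" and "\<not> (int p dvd a \<and> int p dvd b)"
  shows "int p ^ k dvd a \<or> int p ^ k dvd b"
proof -
  have "coprime (int p ^ k) a \<or> coprime (int p ^ k) b"
    using assms by (auto intro: prime_imp_coprime)
  then show ?thesis
    using assms(2) by (auto simp: coprime_dvd_mult_left_iff coprime_dvd_mult_right_iff)
qed

lemma square_roots_of_one_odd_prime_power:
  assumes "prime p" "p \<noteq> 2" "k \<ge> 1"
  shows "square_roots_of_one (int (p ^ k)) = {1, int (p ^ k) - 1}" and "int (p ^ k) > 2"
proof -
  let ?N = "int (p ^ k)"
  have "p > 2"
    using assms prime_ge_2_nat[of p] by simp
  moreover have "p ^ 1 \<le> p ^ k"
    using assms \<open>p > 2\<close> by (intro power_increasing) auto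
  ultimately have "2 < p ^ k" by simp
  then show N: "?N > 2" by (metis of_nat_less_iff of_nat_numeral)
  show "square_roots_of_one ?N = {1, ?N - 1}"
  proof
    show "{1, ?N - 1} \<subseteq> square_roots_of_one ?N"
      using N by (auto simp: square_roots_of_one_def cong_iff_dvd_diff algebra_simps)
    show "square_roots_of_one ?N \<subseteq> {1, ?N - 1}"
    proof
      fix x assume "x \<in> square_roots_of_one ?N"
      then have x: "0 \<le> x" "x < ?N" and "?N dvd (x - 1) * (x + 1)"
        by (auto simp: square_roots_of_one_def cong_iff_dvd_diff algebra_simps)
      moreover have "\<not> (int p dvd x - 1 \<and> int p dvd x + 1)"
      proof
        assume "int p dvd x - 1 \<and> int p dvd x + 1"
        then have "int p dvd (x + 1) - (x - 1)"
          using dvd_diff by blast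
        then show False
          using \<open>p > 2\<close> by (auto dest: zdvd_imp_le)
      qed
      ultimately consider "?N dvd x - 1" | "?N dvd x + 1"
        using prime_power_dvd_mult_cancel[OF assms(1)] by force
      then show "x \<in> {1, ?N - 1}"
      proof cases
        case 1
        then have "x = 1 mod ?N"
          using x by (metis mod_eq_dvd_iff mod_pos_pos_trivial)
        then show ?thesis using N by simp
      next
        case 2
        then have "x + 1 = ?N"
          using x zdvd_imp_le[OF 2] by simp
        then show ?thesis by simp
      qed
    qed
  qed
qed

text \<open>
  A square root of 1 is odd, and for \<open>x = 2 y + 1\<close> the condition $2^k \mid x^2 - 1 = 4 y (y + 1)$ says
  that $2^{k-2}$ divides \<open>y\<close> or \<open>y + 1\<close>, as these are coprime. So \<open>x\<close> is \<open>\<plusminus>1\<close> modulo $2^{k-1}$, and each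
  of these two classes contains two residues modulo $2^k$. The lower bound on $2^{k-1}$ ensures
  that the four residues are distinct.
\<close>

lemma square_roots_of_one_two_power:
  assumes "k \<ge> 3"
  shows "square_roots_of_one (2 ^ k) = {1, 2 ^ (k - 1) - 1, 2 ^ (k - 1) + 1, 2 ^ k - 1}"
    and "(2::int) ^ (k - 1) \<ge> 4"
proof -
  define M :: int where "M = 2 ^ (k - 2)"
  obtain l where l: "k = l + 3"
    using assms by (metis le_add_diff_inverse2)
  have M: "M = 2 * 2 ^ l" and K: "(2::int) ^ (k - 1) = 2 * M" "(2::int) ^ k = 4 * M"
    by (simp_all add: M_def l power_add)
  have M2: "M \<ge> 2" and M_pos: "M > 0" using M by simp_all
  then show "(2::int) ^ (k - 1) \<ge> 4" unfolding K by simp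
  show "square_roots_of_one (2 ^ k) = {1, 2 ^ (k - 1) - 1, 2 ^ (k - 1) + 1, 2 ^ k - 1}"
    unfolding K
  proof
    have "(2 * M - 1) * (2 * M - 1) - 1 = 4 * M * (M - 1)"
      "(2 * M + 1) * (2 * M + 1) - 1 = 4 * M * (M + 1)"
      "(4 * M - 1) * (4 * M - 1) - 1 = 4 * M * (4 * M - 2)"
      by (simp_all add: algebra_simps)
    then have "4 * M dvd (2 * M - 1) * (2 * M - 1) - 1"
      "4 * M dvd (2 * M + 1) * (2 * M + 1) - 1"
      "4 * M dvd (4 * M - 1) * (4 * M - 1) - 1"
      by (metis dvd_triv_left)+
    then show "{1, 2 * M - 1, 2 * M + 1, 4 * M - 1} \<subseteq> square_roots_of_one (4 * M)"
      using M2 by (auto simp: square_roots_of_one_def cong_iff_dvd_diff)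
    show "square_roots_of_one (4 * M) \<subseteq> {1, 2 * M - 1, 2 * M + 1, 4 * M - 1}"
    proof
      fix x assume "x \<in> square_roots_of_one (4 * M)"
      then have x: "0 \<le> x" "x < 4 * M" and dvd: "4 * M dvd x * x - 1"
        by (auto simp: square_roots_of_one_def cong_iff_dvd_diff)
      then have "even (x * x - 1)"
        by (meson dvd_trans dvd_triv_left even_numeral dvd_mult2)
      then obtain y where y: "x = 2 * y + 1"
        by (auto elim: oddE)
      have "x * x - 1 = 4 * (y * (y + 1))"
        by (simp add: y algebra_simps)
      with dvd have "int 2 ^ (k - 2) dvd y * (y + 1)"
        by (simp add: M_def)
      then have "M dvd y \<or> M dvd y + 1"
        using prime_power_dvd_mult_cancel[of 2 "k - 2" y "y + 1"] by (simp add: M_def two_is_prime_nat)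
      then show "x \<in> {1, 2 * M - 1, 2 * M + 1, 4 * M - 1}"
      proof
        assume "M dvd y"
        then obtain c where c: "y = M * c" ..
        have "M * c < M * 2" "M * c > M * (-1)"
          using x y c M2 by linarith+
        then have "c < 2" "c > -1"
          by (simp_all only: mult_less_cancel_left_pos[OF M_pos])
        then have "c = 0 \<or> c = 1" by linarith
        then show ?thesis using y c by auto
      next
        assume "M dvd y + 1"
        then obtain c where c: "y + 1 = M * c" ..
        have "M * c < M * 3" "M * c > M * 0"
          using x y c M2 by linarith+
        then have "c < 3" "c > 0"
          by (simp_all only: mult_less_cancel_left_pos[OF M_pos])
        then have "c = 1 \<or> c = 2" by linarith
        then show ?thesis using y c by auto
      qed
    qed
  qed
qed

lemma card_square_roots_of_one:
  shows card_square_roots_of_one_odd_prime_power: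
      "prime p \<Longrightarrow> p \<noteq> 2 \<Longrightarrow> k \<ge> 1 \<Longrightarrow> card (square_roots_of_one (int (p ^ k))) = 2"
    and card_square_roots_of_one_two: "card (square_roots_of_one 2) = 1"
    and card_square_roots_of_one_four: "card (square_roots_of_one 4) = 2"
    and card_square_roots_of_one_two_power: "k \<ge> 3 \<Longrightarrow> card (square_roots_of_one (2 ^ k)) = 4"
proof -
  show "card (square_roots_of_one (int (p ^ k))) = 2" if "prime p" "p \<noteq> 2" "k \<ge> 1"
    using square_roots_of_one_odd_prime_power[OF that] by simp
  have "{0..<2::int} = {0, 1}" "{0..<4::int} = {0, 1, 2, 3}" by auto
  then have "square_roots_of_one 2 = {1}" "square_roots_of_one 4 = {1, 3}"
    by (auto simp: square_roots_of_one_def cong_def)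
  then show "card (square_roots_of_one 2) = 1" "card (square_roots_of_one 4) = 2"
    by simp_all
  show "card (square_roots_of_one (2 ^ k)) = 4" if "k \<ge> 3"
  proof -
    have "(2::int) ^ k = 2 * 2 ^ (k - 1)"
      using that by (cases k) auto
    moreover have "card {1, c - 1, c + 1, 2 * c - 1} = 4" if "c \<ge> 4" for c :: int
      using that by (simp add: card_insert_if)
    ultimately show ?thesis
      using square_roots_of_one_two_power[OF that] by metis
  qed
qed

text \<open>
  The hypotheses on \<open>a\<close> and \<open>b\<close> say that 0 and 1 are the only idempotents modulo each of them. The
  Chinese remainder theorem then makes \<open>e\<close> and \<open>f\<close> the residues that are congruent to \<open>(1, 0)\<close> and
  \<open>(0, 1)\<close>.
\<close>

lemma idempotents_residue_ring:
  fixes a b :: int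
  assumes "coprime a b" "a > 1" "b > 1"
    and ida: "\<And>x. a dvd x * (x - 1) \<Longrightarrow> a dvd x \<or> a dvd x - 1"
    and idb: "\<And>x. b dvd x * (x - 1) \<Longrightarrow> b dvd x \<or> b dvd x - 1"
  obtains e f where "idempotents (residue_ring (a * b)) = {0, 1, e, f}"
    and "distinct [0, 1, e, f]" and "(e * f) mod (a * b) = 0"
proof -
  let ?N = "a * b"
  have N: "?N > 1"
    using assms(2,3) by (simp add: less_1_mult)
  have bij: "bij_betw (\<lambda>x. (x mod a, x mod b)) {0..<?N} ({0..<a} \<times> {0..<b})"
    using assms by (intro chinese_remainder_bij_betw) auto
  have inj: "x = y" if "x \<in> {0..<?N}" "y \<in> {0..<?N}" "x mod a = y mod a" "x mod b = y mod b" for x y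
    using bij that by (auto simp: bij_betw_def inj_on_def)
  have surj: "\<exists>x\<in>{0..<?N}. x mod a = r \<and> x mod b = s" if "r \<in> {0..<a}" "s \<in> {0..<b}" for r s
  proof -
    have "(r, s) \<in> (\<lambda>x. (x mod a, x mod b)) ` {0..<?N}"
      using bij that by (simp add: bij_betw_def)
    then show ?thesis by auto
  qed
  obtain e where e: "e \<in> {0..<?N}" "e mod a = 1" "e mod b = 0"
    using surj[of 1 0] assms by auto
  obtain f where f: "f \<in> {0..<?N}" "f mod a = 0" "f mod b = 1"
    using surj[of 0 1] assms by auto
  have idem: "x \<in> idempotents (residue_ring ?N) \<longleftrightarrow>
      x \<in> {0..<?N} \<and> x mod a \<in> {0, 1} \<and> x mod b \<in> {0, 1}" for x
  proof -
    have "?N dvd x * (x - 1) \<longleftrightarrow> a dvd x * (x - 1) \<and> b dvd x * (x - 1)"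
      using assms(1) by (meson divides_mult dvd_mult_left dvd_mult_right)
    moreover have "c dvd x - 1 \<longleftrightarrow> x mod c = 1" if "c > 1" for c
      using that by (metis mod_eq_dvd_iff mod_pos_pos_trivial zero_le_one)
    moreover have "(x * x) mod ?N = x \<longleftrightarrow> ?N dvd x * (x - 1)" if "x \<in> {0..<?N}"
      using that by (metis atLeastLessThan_iff mod_eq_dvd_iff mod_pos_pos_trivial mult.right_neutral right_diff_distrib)
    ultimately show ?thesis
      using ida[of x] idb[of x] assms(2,3)
      by (auto simp: idempotents_def residue_ring_def mod_eq_0_iff_dvd)
  qed
  have one: "1 \<in> {0..<?N}" "1 mod a = 1" "1 mod b = 1" and zero: "0 \<in> {0..<?N}"
    using N assms by auto
  show thesis
  proof (rule that)
    show "idempotents (residue_ring ?N) = {0, 1, e, f}"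
    proof
      show "idempotents (residue_ring ?N) \<subseteq> {0, 1, e, f}"
      proof
        fix x assume "x \<in> idempotents (residue_ring ?N)"
        then have "x \<in> {0..<?N}" "x mod a = 0 \<or> x mod a = 1" "x mod b = 0 \<or> x mod b = 1"
          by (auto simp: idem)
        then show "x \<in> {0, 1, e, f}"
          using inj[of x 0] inj[of x 1] inj[of x e] inj[of x f] e f one zero by auto
      qed
      show "{0, 1, e, f} \<subseteq> idempotents (residue_ring ?N)"
        using e f one zero by (auto simp: idem)
    qed
    show "distinct [0, 1, e, f]"
      using e f one by auto
    have "a dvd f" "b dvd e"
      using e f by auto
    then have "a * b dvd f * e"
      by (rule mult_dvd_mono)
    then show "(e * f) mod ?N = 0"
      by (simp add: mult.commute)
  qed
qed

lemma prime_power_idempotent: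
  assumes "prime p" and "int (p ^ k) dvd x * (x - 1)"
  shows "int (p ^ k) dvd x \<or> int (p ^ k) dvd x - 1"
proof -
  have "\<not> (int p dvd x \<and> int p dvd x - 1)"
  proof
    assume "int p dvd x \<and> int p dvd x - 1"
    then have "int p dvd x - (x - 1)"
      using dvd_diff by blast
    then show False
      using assms(1) by auto
  qed
  then show ?thesis
    using prime_power_dvd_mult_cancel[of p k x "x - 1"] assms by simp
qed

section \<open>The clean graph modulo a product of two prime powers\<close>

text \<open>
  The four cases of the proposition differ only in the two numbers of square roots of 1.
\<close>

theorem Cl2_prime_powers_iso_shuriken:
  fixes p q n m :: nat
  assumes p: "prime p" and q: "prime q" and "p \<noteq> q" and n: "n \<ge> 1" and m: "m \<ge> 1"
  shows "digraph_iso (with_proj (Cl2 (residue_ring (int (p ^ n * q ^ m)))))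
    (with_proj (shuriken
      (card (square_roots_of_one (int (p ^ n))) * card (square_roots_of_one (int (q ^ m))))
      ((p ^ n - p ^ (n - 1)) * (q ^ m - q ^ (m - 1)))))"
proof -
  define a where "a = int (p ^ n)"
  define b where "b = int (q ^ m)"
  have ab: "int (p ^ n * q ^ m) = a * b"
    by (simp add: a_def b_def)
  have cop: "coprime (p ^ n) (q ^ m)"
    using assms by (simp add: primes_coprime)
  then have cop_ab: "coprime a b"
    unfolding a_def b_def by (simp only: coprime_int_iff)
  have gt1: "a > 1" "b > 1"
    using prime_gt_1_nat[OF p] prime_gt_1_nat[OF q] n m by (simp_all add: a_def b_def one_less_power)
  define R where "R = residue_ring (a * b)"
  interpret R: residues "a * b" R
    using gt1 by unfold_locales (auto simp: R_def less_1_mult)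
  obtain e f where ef: "idempotents R = {0, 1, e, f}" "distinct [0, 1, e, f]" "(e * f) mod (a * b) = 0"
    using idempotents_residue_ring[OF cop_ab gt1] prime_power_idempotent[OF p] prime_power_idempotent[OF q]
    unfolding R_def a_def b_def by blast
  have iso: "digraph_iso (with_proj (Cl2 R))
      (with_proj (shuriken (card {u \<in> Units R. u \<otimes>\<^bsub>R\<^esub> u = \<one>\<^bsub>R\<^esub>}) (card (Units R))))"
    using ef by (intro R.Cl2_iso_shuriken[where e = e and f = f])
      (simp_all add: R.res_zero_eq R.res_one_eq R.res_mult_eq)
  have "{u \<in> Units R. u \<otimes>\<^bsub>R\<^esub> u = \<one>\<^bsub>R\<^esub>} = square_roots_of_one (a * b)"
    using R.m_gt_one
    by (auto simp: Units_def square_roots_of_one_def R.res_carrier_eq R.res_mult_eq R.res_one_eq cong_def)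
  then have t: "card {u \<in> Units R. u \<otimes>\<^bsub>R\<^esub> u = \<one>\<^bsub>R\<^esub>} =
      card (square_roots_of_one a) * card (square_roots_of_one b)"
    using card_square_roots_of_one_mult[OF cop_ab] gt1 by simp
  have tot: "totient (r ^ k) = r ^ k - r ^ (k - 1)" if "prime r" "k \<ge> 1" for r k :: nat
    using that totient_prime_power[of r k] by (cases k) (simp_all add: diff_mult_distrib2 mult.commute)
  have "card (Units R) = totient (p ^ n * q ^ m)"
    using R.totient_eq ab nat_int by metis
  also have "\<dots> = (p ^ n - p ^ (n - 1)) * (q ^ m - q ^ (m - 1))"
    using cop tot[OF p n] tot[OF q m] by (simp add: totient_mult_coprime)
  finally show ?thesis
    using iso unfolding t ab a_def[symmetric] b_def[symmetric] R_def[symmetric] by (simp only:)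
qed

theorem proposition1:
  fixes p q n m :: nat
  assumes "prime p" and "prime q" and "p \<noteq> q" and "n \<ge> 1" and "m \<ge> 1"
  shows "let G = Cl2 (residue_ring (int (p ^ n * q ^ m))) in
    (p ^ n = 2 \<longrightarrow>
      digraph_iso (with_proj G) (with_proj (shuriken 2 (q ^ m - q ^ (m - 1))))) \<and>
    (p ^ n = 4 \<longrightarrow>
      digraph_iso (with_proj G) (with_proj (shuriken 4 (2 * (q ^ m - q ^ (m - 1)))))) \<and>
    (p = 2 \<and> n \<ge> 3 \<longrightarrow>
      digraph_iso (with_proj G)
        (with_proj (shuriken 8 ((p ^ n - p ^ (n - 1)) * (q ^ m - q ^ (m - 1)))))) \<and>
    (p \<noteq> 2 \<and> q \<noteq> 2 \<longrightarrow>
      digraph_iso (with_proj G)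
        (with_proj (shuriken 4 ((p ^ n - p ^ (n - 1)) * (q ^ m - q ^ (m - 1))))))"
proof -
  define G where "G = Cl2 (residue_ring (int (p ^ n * q ^ m)))"
  let ?c = "\<lambda>N. card (square_roots_of_one (int N))"
  have iso: "digraph_iso (with_proj G) (with_proj (shuriken (?c (p ^ n) * ?c (q ^ m))
      ((p ^ n - p ^ (n - 1)) * (q ^ m - q ^ (m - 1)))))"
    unfolding G_def using assms by (rule Cl2_prime_powers_iso_shuriken)
  have odd: "?c (r ^ k) = 2" if "prime r" "r \<noteq> 2" "k \<ge> 1" for r k
    using that by (rule card_square_roots_of_one_odd_prime_power)
  have p2: "p = 2" "p ^ (n - 1) * 2 = p ^ n" if "even (p ^ n)"
  proof -
    have "2 dvd p"
      using that by simp
    then show "p = 2"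
      using assms(1) two_is_prime_nat primes_dvd_imp_eq by blast
    then show "p ^ (n - 1) * 2 = p ^ n"
      using assms(4) by (cases n) auto
  qed
  have "digraph_iso (with_proj G) (with_proj (shuriken 2 (q ^ m - q ^ (m - 1))))" if "p ^ n = 2"
  proof -
    have *: "?c (q ^ m) = 2" "p ^ (n - 1) = 1"
      using p2 that assms odd by auto
    then show ?thesis
      using iso unfolding that * by (simp add: card_square_roots_of_one_two)
  qed
  moreover have "digraph_iso (with_proj G) (with_proj (shuriken 4 (2 * (q ^ m - q ^ (m - 1)))))"
    if "p ^ n = 4"
  proof -
    have *: "?c (q ^ m) = 2" "p ^ (n - 1) = 2"
      using p2 that assms odd by auto
    then show ?thesis
      using iso unfolding that * by (simp add: card_square_roots_of_one_four)
  qed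
  moreover have "digraph_iso (with_proj G)
      (with_proj (shuriken 8 ((p ^ n - p ^ (n - 1)) * (q ^ m - q ^ (m - 1)))))"
    if "p = 2" "n \<ge> 3"
  proof -
    have "?c (q ^ m) = 2"
      using that assms odd by auto
    moreover have "?c (p ^ n) = 4"
      using that card_square_roots_of_one_two_power by simp
    ultimately show ?thesis
      using iso by simp
  qed
  moreover have "digraph_iso (with_proj G)
      (with_proj (shuriken 4 ((p ^ n - p ^ (n - 1)) * (q ^ m - q ^ (m - 1)))))"
    if "p \<noteq> 2" "q \<noteq> 2"
  proof -
    have "?c (p ^ n) = 2" "?c (q ^ m) = 2"
      using that assms odd by auto
    then show ?thesis
      using iso by simp
  qed
  ultimately show ?thesis
    unfolding Let_def G_def by blast
qed

end
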